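(* $$\sum_{n=1}^{\infty}\frac{1}{n^4\binom{2n}{n}}=\frac{17\pi^4}{3240}.$$
   Context: Here $\binom{2n}{n}$ is the central binomial coefficient. *)

theory Defs
  imports Complex_Main
begin

end

theory Submission
  imports Defs "HOL-Analysis.Analysis"
begin

text \<open>
Write \<open>C\<^sub>k\<close> for the central binomial coefficient, \<open>h\<^sub>k = \<Sum>j<k. 1/j\<^sup>2\<close> (over \<open>j \<ge> 1\<close>),
\<open>S\<close> for the series to be evaluated and \<open>T = \<Sum>k. h\<^sub>k / (k\<^sup>2 C\<^sub>k)\<close>. The value of \<open>S\<close> comes out
of a linear relation between \<open>S\<close>, \<open>T\<close> and the alternating series \<open>\<eta>(4)\<close>, namely Leshchiner's identity
\<open>\<eta>(4) = 2 S - (3/2) T\<close>, in which the other two quantities are known: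
\<open>\<eta>(4) = 7\<pi>\<^sup>4/720\<close> and \<open>T = \<pi>\<^sup>4/1944\<close>.

The relation (\<open>leshchiner_finite\<close>) holds for partial sums up to an explicit remainder of size \<open>O(1/n)\<close>.
It arises from Apery's telescoping expansion of \<open>1/(n\<^sup>2 - x\<^sup>2)\<close> in the products
\<open>(1\<^sup>2 - x\<^sup>2)\<cdots>((k-1)\<^sup>2 - x\<^sup>2) / ((n\<^sup>2 - 1\<^sup>2)\<cdots>(n\<^sup>2 - k\<^sup>2))\<close>: take the coefficient of \<open>x\<^sup>2\<close>, multiply
by \<open>(-1)\<^sup>n\<close> and sum over \<open>n\<close>; for fixed \<open>k\<close> the sum over \<open>n\<close> telescopes as well.

The value of \<open>T\<close> (\<open>hsum_inv_cb_tendsto\<close>) comes from the expansion of \<open>t\<^sup>4/24\<close> in powers of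
\<open>2 - 2 cos t = (2 sin (t/2))\<^sup>2\<close>, which at \<open>t = \<pi>/3\<close> takes the value 1. The second derivative in \<open>t\<close>
turns the series for \<open>t\<^sup>4/24\<close> into the one for \<open>t\<^sup>2/2\<close>, and that one into the constant 1. For
partial sums the same computation leaves a single boundary term that tends to 0 uniformly, so that
no exchange of limit and derivative is needed.

Finally \<open>\<zeta>(4) = \<pi>\<^sup>4/90\<close> (\<open>hsum_4_tendsto\<close>), hence the value of \<open>\<eta>(4)\<close>, is read off the coefficient
of \<open>x\<^sup>4\<close> in the product for \<open>sin (\<pi>x) / (\<pi>x)\<close>.
\<close>

section \<open>Generalized harmonic numbers\<close>

definition hsum :: "nat \<Rightarrow> nat \<Rightarrow> real" where
  "hsum s n = (\<Sum>k<n. 1 / real (Suc k) ^ s)"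

definition inv_cb :: "nat \<Rightarrow> real" where
  "inv_cb n = 1 / real ((2 * n) choose n)"

lemma hsum_0 [simp]: "hsum s 0 = 0"
  and hsum_Suc: "hsum s (Suc n) = hsum s n + 1 / real (Suc n) ^ s"
  by (simp_all add: hsum_def)

lemma hsum_nonneg [simp]: "hsum s n \<ge> 0"
  unfolding hsum_def by (intro sum_nonneg) simp

lemma hsum_2_tendsto: "hsum 2 \<longlonglongrightarrow> pi\<^sup>2 / 6"
  using inverse_squares_sums by (simp add: sums_def hsum_def[abs_def] add.commute)

lemma hsum_2_le: "hsum 2 n \<le> pi\<^sup>2 / 6"
proof -
  have "incseq (hsum 2)"
    by (rule incseq_SucI) (simp add: hsum_Suc)
  then show ?thesis using hsum_2_tendsto by (rule incseq_le)
qed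

section \<open>The value of \<open>\<zeta>(4)\<close>\<close>

text \<open>
The left-hand side is the second elementary symmetric polynomial of the numbers \<open>1/k\<^sup>2\<close>, so that
this is Newton's identity.
\<close>
lemma sum_hsum_2_eq:
  "(\<Sum>k<n. hsum 2 k / real (Suc k)^2) = (hsum 2 n ^ 2 - hsum 4 n) / 2"
proof (induction n)
  case (Suc n)
  have "1 / real (Suc n) ^ 4 = (1 / real (Suc n) ^ 2)^2"
    by (simp add: power_divide flip: power_mult)
  with Suc show ?case
    by (simp add: hsum_Suc power2_eq_square algebra_simps add_divide_distrib del: of_nat_Suc)
qed simp

text \<open>
The coefficients of the product up to order \<open>q\<^sup>2\<close> are elementary symmetric polynomials of the numbers
\<open>1/k\<^sup>2\<close>; a new factor \<open>1 - q a\<close> shrinks the old error and adds at most \<open>q\<^sup>3\<close> times the increment of the third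
elementary symmetric polynomial. A bound that is cubic in \<open>q = x\<^sup>2\<close> with a constant bounded in \<open>n\<close> allows
the coefficient of \<open>x\<^sup>4\<close> to be compared after \<open>n\<close> has gone to infinity.
\<close>
lemma sine_product_expansion:
  fixes q :: real
  assumes "0 \<le> q" "q \<le> 1"
  shows "\<bar>(\<Prod>k<n. 1 - q / real (Suc k)^2) - 1 + q * hsum 2 n - q^2 * (\<Sum>k<n. hsum 2 k / real (Suc k)^2)\<bar>
           \<le> q^3 * (\<Sum>k<n. (\<Sum>j<k. hsum 2 j / real (Suc j)^2) / real (Suc k)^2)"
proof (induction n)
  case (Suc n)
  define P where "P = (\<Prod>k<n. 1 - q / real (Suc k)^2)"
  define E where "E = (\<Sum>k<n. hsum 2 k / real (Suc k)^2)"
  define M where "M = (\<Sum>k<n. (\<Sum>j<k. hsum 2 j / real (Suc j)^2) / real (Suc k)^2)"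
  define a where "a = 1 / real (Suc n)^2"
  have a: "0 \<le> a" "a \<le> 1" by (auto simp: a_def divide_simps)
  have E: "E \<ge> 0" unfolding E_def by (intro sum_nonneg) simp
  have "q * a \<le> 1 * 1" using a assms by (intro mult_mono) auto
  then have qa: "0 \<le> q * a" "q * a \<le> 1" using a assms by auto
  let ?R = "P - 1 + q * hsum 2 n - q^2 * E"
  have IH: "\<bar>?R\<bar> \<le> q^3 * M" using Suc unfolding P_def E_def M_def .
  have "P * (1 - q * a) - 1 + q * (hsum 2 n + a) - q^2 * (E + hsum 2 n * a)
          = ?R * (1 - q * a) - q^3 * (E * a)"
    by (simp add: algebra_simps power2_eq_square power3_eq_cube)
  also have "\<bar>\<dots>\<bar> \<le> \<bar>?R * (1 - q * a)\<bar> + \<bar>q^3 * (E * a)\<bar>"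
    by (rule abs_triangle_ineq4)
  also have "\<bar>?R * (1 - q * a)\<bar> \<le> \<bar>?R\<bar> * 1"
    unfolding abs_mult using qa by (intro mult_left_mono) auto
  also have "\<bar>q^3 * (E * a)\<bar> = q^3 * (E * a)" using E a assms by simp
  finally have "\<bar>P * (1 - q * a) - 1 + q * (hsum 2 n + a) - q^2 * (E + hsum 2 n * a)\<bar>
          \<le> q^3 * (M + E * a)"
    using IH by (simp add: algebra_simps)
  then show ?case
    by (simp add: P_def E_def M_def a_def hsum_Suc del: of_nat_Suc)
qed simp

lemma sine_taylor_bound:
  fixes x :: real
  shows "\<bar>sin x - (x - x^3 / 6 + x^5 / 120)\<bar> \<le> \<bar>x\<bar>^7"
proof -
  have "(\<Sum>m<7. g m) = g 0 + g 1 + g 2 + g 3 + g 4 + g 5 + g 6" for g :: "nat \<Rightarrow> real"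
    by (simp add: eval_nat_numeral)
  then have "(\<Sum>m<7. sin_coeff m * x ^ m) = x - x^3 / 6 + x^5 / 120"
    by (simp add: sin_coeff_def fact_numeral)
  moreover have "inverse (fact 7) * \<bar>x\<bar>^7 \<le> 1 * \<bar>x\<bar>^7"
    by (intro mult_right_mono) (auto simp: fact_numeral)
  ultimately show ?thesis using Maclaurin_sin_bound[of x 7] by simp
qed

text \<open>
Both the product and the Taylor series approximate \<open>sin (\<pi>x) / (\<pi>x)\<close> up to \<open>O(x\<^sup>6)\<close> and agree in the
constant and quadratic terms, hence their coefficients of \<open>x\<^sup>4\<close> are equal.
\<close>
lemma hsum_4_tendsto: "hsum 4 \<longlonglongrightarrow> pi^4 / 90"
proof -
  have "summable (\<lambda>k. 1 / real (Suc k) ^ 4)"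
    using inverse_power_summable[of 4, where 'a = real]
    by (subst summable_Suc_iff) (simp add: inverse_eq_divide)
  then obtain L where L: "hsum 4 \<longlonglongrightarrow> L"
    unfolding summable_def sums_def hsum_def[abs_def] by blast
  define e2 where "e2 n = (\<Sum>k<n. hsum 2 k / real (Suc k)^2)" for n
  define Z where "Z = pi^2 / 6"
  define K where "K = ((Z^2 - L) / 2)"
  have e2_lim: "e2 \<longlonglongrightarrow> K"
    unfolding e2_def[abs_def] sum_hsum_2_eq K_def Z_def
    by (intro tendsto_intros L hsum_2_tendsto) auto
  have e2_le: "e2 n \<le> Z * Z" for n
  proof -
    have "e2 n \<le> (\<Sum>k<n. Z / real (Suc k)^2)"
      unfolding e2_def Z_def by (intro sum_mono divide_right_mono hsum_2_le) auto
    also have "\<dots> = Z * hsum 2 n" by (simp add: hsum_def sum_distrib_left)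
    also have "\<dots> \<le> Z * Z" using hsum_2_le by (intro mult_left_mono) (auto simp: Z_def)
    finally show ?thesis .
  qed
  have e3_le: "(\<Sum>k<n. e2 k / real (Suc k)^2) \<le> Z * Z * Z" for n
  proof -
    have "(\<Sum>k<n. e2 k / real (Suc k)^2) \<le> (\<Sum>k<n. Z * Z / real (Suc k)^2)"
      by (intro sum_mono divide_right_mono e2_le) auto
    also have "\<dots> = Z * Z * hsum 2 n" by (simp add: hsum_def sum_distrib_left)
    also have "\<dots> \<le> Z * Z * Z" using hsum_2_le by (intro mult_left_mono) (auto simp: Z_def)
    finally show ?thesis .
  qed
  have bound: "\<bar>pi^4 / 120 - K\<bar> \<le> (Z * Z * Z + pi^6) * x^2" if x: "0 < x" "x \<le> 1" for x :: real
  proof -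
    let ?s = "sin (pi * x) / (pi * x)"
    have x2: "x^2 \<le> 1" using x by (simp add: power_le_one)
    have lim: "(\<lambda>n. \<bar>(\<Prod>k<n. 1 - x^2 / real (Suc k)^2) - 1 + x^2 * hsum 2 n - (x^2)^2 * e2 n\<bar>)
            \<longlonglongrightarrow> \<bar>?s - 1 + x^2 * (pi^2/6) - (x^2)^2 * K\<bar>"
      using sin_product_formula_real'[of x] x
      by (intro tendsto_intros e2_lim hsum_2_tendsto) (simp_all add: prod.atLeast1_atMost_eq)
    have "\<bar>?s - 1 + x^2 * (pi^2/6) - (x^2)^2 * K\<bar> \<le> (x^2)^3 * (Z * Z * Z)"
    proof (rule LIMSEQ_le_const2[OF lim], intro exI[of _ 0] allI impI)
      fix n
      have "\<bar>(\<Prod>k<n. 1 - x^2 / real (Suc k)^2) - 1 + x^2 * hsum 2 n - (x^2)^2 * e2 n\<bar>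
              \<le> (x^2)^3 * (\<Sum>k<n. e2 k / real (Suc k)^2)"
        unfolding e2_def by (rule sine_product_expansion) (use x2 in auto)
      also have "\<dots> \<le> (x^2)^3 * (Z * Z * Z)"
        by (intro mult_left_mono e3_le) auto
      finally show "\<bar>(\<Prod>k<n. 1 - x^2 / real (Suc k)^2) - 1 + x^2 * hsum 2 n - (x^2)^2 * e2 n\<bar>
         \<le> (x^2)^3 * (Z * Z * Z)" .
    qed
    moreover have "\<bar>?s - 1 + x^2 * (pi^2/6) - (x^2)^2 * (pi^4/120)\<bar> \<le> (x^2)^3 * pi^6"
    proof -
      have "?s - 1 + x^2 * (pi^2/6) - (x^2)^2 * (pi^4/120)
              = (sin (pi*x) - (pi*x - (pi*x)^3 / 6 + (pi*x)^5 / 120)) / (pi * x)"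
        using x by (simp add: field_simps power_mult_distrib eval_nat_numeral)
      also have "\<bar>\<dots>\<bar> \<le> \<bar>pi*x\<bar>^7 / (pi*x)"
        unfolding abs_divide using x sine_taylor_bound[of "pi*x"] by (simp add: divide_right_mono)
      also have "\<dots> = (x^2)^3 * pi^6"
        using x by (simp add: field_simps eval_nat_numeral abs_mult)
      finally show ?thesis .
    qed
    ultimately have "\<bar>(x^2)^2 * (pi^4/120) - (x^2)^2 * K\<bar> \<le> (x^2)^3 * (Z*Z*Z) + (x^2)^3 * pi^6"
      by linarith
    then have "(x^2)^2 * \<bar>pi^4/120 - K\<bar> \<le> (x^2)^2 * ((Z*Z*Z + pi^6) * x^2)"
      unfolding right_diff_distrib[symmetric] abs_mult power2_abs abs_power2
      by (simp add: power3_eq_cube power2_eq_square algebra_simps)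
    then show ?thesis using x by (subst (asm) mult_le_cancel_left_pos) auto
  qed
  have "(\<lambda>n. (Z * Z * Z + pi^6) * (1 / real (Suc n))^2) \<longlonglongrightarrow> (Z * Z * Z + pi^6) * 0^2"
    by (intro tendsto_intros LIMSEQ_Suc lim_1_over_n)
  then have "\<bar>pi^4 / 120 - K\<bar> \<le> (Z * Z * Z + pi^6) * 0^2"
    by (rule LIMSEQ_le_const) (auto intro!: bound)
  then have "K = pi^4 / 120" by simp
  then have "L = pi^4 / 90" by (simp add: K_def Z_def field_simps power2_eq_square eval_nat_numeral)
  with L show ?thesis by simp
qed

text \<open>
Removing the even terms twice costs \<open>2 \<cdot> 2\<^sup>-\<^sup>4 = 1/8\<close> of a partial sum of half the length.
\<close>
lemma alternating_hsum_4_tendsto: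
  "(\<lambda>n. \<Sum>k<n. (-1)^k / real (Suc k)^4) \<longlonglongrightarrow> 7 * pi^4 / 720"
proof -
  have eq: "(\<Sum>k<n. (-1)^k / real (Suc k)^4) = hsum 4 n - hsum 4 (n div 2) / 8" for n
  proof (induction n)
    case (Suc n)
    show ?case
    proof (cases "even n")
      case False
      then obtain m where n: "n = Suc (2 * m)" by (auto elim: oddE)
      have "real (Suc n) ^ 4 = 16 * real (Suc m)^4"
        by (simp add: n algebra_simps eval_nat_numeral)
      with Suc show ?thesis by (simp add: hsum_Suc n add_divide_distrib del: of_nat_Suc)
    qed (use Suc in \<open>auto simp: hsum_Suc\<close>)
  qed simp
  have "filterlim (\<lambda>n::nat. n div 2) at_top at_top"
    by (rule filterlim_at_top_div_const_nat) simp
  then have "(\<lambda>n. hsum 4 (n div 2)) \<longlonglongrightarrow> pi^4 / 90"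
    by (rule filterlim_compose[OF hsum_4_tendsto])
  then have "(\<lambda>n. hsum 4 n - hsum 4 (n div 2) / 8) \<longlonglongrightarrow> pi^4/90 - pi^4/90/8"
    by (intro tendsto_intros hsum_4_tendsto) auto
  then show ?thesis by (simp add: eq del: of_nat_Suc)
qed

section \<open>The fourth power of the angle\<close>

lemma inv_cb_pos: "inv_cb n > 0"
  by (simp add: inv_cb_def zero_less_binomial)

lemma inv_cb_fact: "inv_cb n = (fact n)\<^sup>2 / fact (2 * n)"
  unfolding inv_cb_def by (subst binomial_fact) (simp_all add: power2_eq_square)

lemma inv_cb_Suc: "inv_cb (Suc n) * (4 * real n + 2) = inv_cb n * real (Suc n)"
proof -
  have "fact (2 * Suc n) = (real (Suc n) * (4 * real n + 2)) * fact (2 * n)"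
    by (simp add: algebra_simps)
  then show ?thesis
    by (simp add: inv_cb_fact power2_eq_square divide_simps del: of_nat_Suc mult_Suc_right)
qed

lemma binomial_add_ge:
  "n + 1 \<le> (n + Suc k) choose (Suc k)"
  by (induction k) auto

lemma inv_cb_le: "inv_cb n \<le> 1 / real (Suc n)"
proof (cases n)
  case (Suc k)
  have "real (n + 1) \<le> real ((2 * n) choose n)"
    using binomial_add_ge[of n k] Suc by (simp only: of_nat_le_iff mult_2)
  then show ?thesis by (simp add: inv_cb_def frac_le)
qed (simp add: inv_cb_def)

lemma inv_cb_tendsto_0: "inv_cb \<longlonglongrightarrow> 0"
proof (rule tendsto_sandwich[OF _ _ tendsto_const])
  show "(\<lambda>n. 1 / real (Suc n)) \<longlonglongrightarrow> 0" by (rule LIMSEQ_Suc[OF lim_1_over_n])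
qed (auto intro!: always_eventually inv_cb_le less_imp_le[OF inv_cb_pos] simp del: of_nat_Suc)

lemma abs_le_of_deriv_bound:
  fixes f f' :: "real \<Rightarrow> real"
  assumes "\<And>x. 0 \<le> x \<Longrightarrow> x \<le> a \<Longrightarrow> (f has_real_derivative f' x) (at x)"
    and "\<And>x. 0 \<le> x \<Longrightarrow> x \<le> a \<Longrightarrow> \<bar>f' x\<bar> \<le> B"
    and "f 0 = 0" and "0 \<le> x" "x \<le> a"
  shows "\<bar>f x\<bar> \<le> B * a"
proof (cases "x = 0")
  case True
  have "0 \<le> B" using assms(2)[of 0] assms by linarith
  then show ?thesis using True assms by simp
next
  case False
  then obtain z where z: "0 < z" "z < x" "f x - f 0 = (x - 0) * f' z"
    using MVT2[of 0 x f f'] assms by force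
  then have "\<bar>f x\<bar> = \<bar>f' z\<bar> * x" using assms by (simp add: abs_mult)
  also have "\<dots> \<le> B * a"
    using assms(2)[of z] z assms by (intro mult_mono) linarith+
  finally show ?thesis .
qed

lemma abs_le_of_second_deriv_bound:
  fixes f f' f'' :: "real \<Rightarrow> real"
  assumes "\<And>x. (f has_real_derivative f' x) (at x)"
    and "\<And>x. (f' has_real_derivative f'' x) (at x)"
    and "\<And>x. 0 \<le> x \<Longrightarrow> x \<le> a \<Longrightarrow> \<bar>f'' x\<bar> \<le> B"
    and "f 0 = 0" "f' 0 = 0" and "0 \<le> x" "x \<le> a"
  shows "\<bar>f x\<bar> \<le> B * a * a"
proof (rule abs_le_of_deriv_bound[of a f f'])
  show "\<bar>f' x\<bar> \<le> B * a" if "0 \<le> x" "x \<le> a" for x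
    by (rule abs_le_of_deriv_bound[of a f' f'']) (use assms that in auto)
qed (use assms in auto)

text \<open>
The quantity \<open>2 - 2 cos t\<close> is the squared length of the chord of the unit circle that subtends the
angle \<open>t\<close>.
\<close>
definition chord_sum :: "(nat \<Rightarrow> real) \<Rightarrow> nat \<Rightarrow> real \<Rightarrow> real" where
  "chord_sum c n t = (\<Sum>k<n. c k * inv_cb (Suc k) / real (Suc k)^2 * (2 - 2 * cos t) ^ Suc k)"

definition chord_sum' :: "(nat \<Rightarrow> real) \<Rightarrow> nat \<Rightarrow> real \<Rightarrow> real" where
  "chord_sum' c n t = (\<Sum>k<n. c k * inv_cb (Suc k) / real (Suc k) * (2 - 2 * cos t) ^ k * (2 * sin t))"

lemma chord_sum_0 [simp]: "chord_sum c n 0 = 0" "chord_sum' c n 0 = 0"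
  by (simp_all add: chord_sum_def chord_sum'_def)

lemma chord_sum_deriv: "(chord_sum c n has_real_derivative chord_sum' c n t) (at t)"
  unfolding chord_sum_def[abs_def] chord_sum'_def
  by (rule derivative_eq_intros refl | simp)+
     (auto intro!: sum.cong simp: power2_eq_square divide_simps simp del: of_nat_Suc)

text \<open>
With \<open>Y = 2 - 2 cos t\<close> one has \<open>Y' = 2 sin t\<close>, \<open>Y'\<^sup>2 = Y (4 - Y)\<close> and \<open>Y'' = 2 - Y\<close>, so that second derivatives of
polynomials in \<open>Y\<close> are again polynomials in \<open>Y\<close>.
\<close>
lemma chord_power_deriv:
  "((\<lambda>t. (2 - 2 * cos t) ^ k * (2 * sin t)) has_real_derivative
      ((4 * real k + 2) * (2 - 2 * cos t)^k - real (Suc k) * (2 - 2 * cos t) ^ Suc k)) (at t)"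
proof -
  let ?Y = "2 - 2 * cos t"
  have s: "(2 * sin t) * (2 * sin t) = ?Y * (4 - ?Y)"
  proof -
    have "(2 * sin t) * (2 * sin t) = 4 * (1 - cos t ^ 2)"
      unfolding sin_squared_eq[symmetric] by (simp add: power2_eq_square)
    then show ?thesis by (simp add: power2_eq_square algebra_simps)
  qed
  have "real k * ?Y^(k-1) * (2 * sin t) * (2 * sin t) + ?Y^k * (2 * cos t)
         = real k * ?Y^k * (4 - ?Y) + ?Y^k * (2 - ?Y)"
  proof (cases k)
    case (Suc j)
    have "real k * ?Y^(k-1) * (2 * sin t) * (2 * sin t) = real k * ?Y^j * ((2 * sin t) * (2 * sin t))"
      by (simp add: Suc)
    then show ?thesis unfolding s by (simp add: Suc)
  qed simp
  also have "\<dots> = (4 * real k + 2) * ?Y^k - real (Suc k) * ?Y ^ Suc k"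
    by (simp add: algebra_simps)
  finally show ?thesis
    by - ((rule derivative_eq_intros refl | simp)+, simp only: mult_ac)
qed

text \<open>
The factors \<open>1 / (k\<^sup>2 C\<^sub>k)\<close> in the definition of \<open>chord_sum\<close> are chosen such that the two contributions
to each power of the squared chord have equal weight: the second derivative of a chord sum
telescopes when \<open>c\<close> is constant.
\<close>
lemma chord_sum'_deriv:
  "(chord_sum' c n has_real_derivative
      (\<Sum>k<n. c k * (inv_cb k * (2 - 2 * cos t)^k - inv_cb (Suc k) * (2 - 2 * cos t)^Suc k))) (at t)"
proof -
  have eq: "c k * inv_cb (Suc k) / real (Suc k) *
         ((4 * real k + 2) * (2 - 2 * cos t)^k - real (Suc k) * (2 - 2 * cos t) ^ Suc k)
      = c k * (inv_cb k * (2 - 2 * cos t)^k - inv_cb (Suc k) * (2 - 2 * cos t)^Suc k)" for k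
  proof -
    have "c k * inv_cb (Suc k) / real (Suc k) *
         ((4 * real k + 2) * (2 - 2 * cos t)^k - real (Suc k) * (2 - 2 * cos t) ^ Suc k)
       = c k * ((inv_cb (Suc k) * (4 * real k + 2)) / real (Suc k) * (2 - 2 * cos t)^k
            - inv_cb (Suc k) * (2 - 2 * cos t) ^ Suc k)"
      by (simp add: field_simps del: of_nat_Suc power_Suc)
    then show ?thesis unfolding inv_cb_Suc by simp
  qed
  have "(chord_sum' c n has_real_derivative
      (\<Sum>k<n. c k * inv_cb (Suc k) / real (Suc k) *
         ((4 * real k + 2) * (2 - 2 * cos t)^k - real (Suc k) * (2 - 2 * cos t) ^ Suc k))) (at t)"
    unfolding chord_sum'_def[abs_def] mult.assoc[of _ "_ ^ _"]
    by (intro DERIV_sum DERIV_cmult chord_power_deriv)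
  then show ?thesis by (simp only: eq)
qed

lemma chord_in_unit:
  assumes "0 \<le> t" "t \<le> pi / 3"
  shows "0 \<le> 2 - 2 * cos t" "2 - 2 * cos t \<le> 1"
proof -
  have "cos (pi/3) \<le> cos t" using assms by (intro cos_monotone_0_pi_le) auto
  then show "2 - 2 * cos t \<le> 1" by (simp add: cos_60)
qed simp

lemma chord_sum_const_bound:
  assumes "0 \<le> t" "t \<le> pi / 3"
  shows "\<bar>chord_sum (\<lambda>_. 1) n t - t^2 / 2\<bar> \<le> inv_cb n * (pi/3) * (pi/3)"
proof (rule abs_le_of_second_deriv_bound[of "\<lambda>t. chord_sum (\<lambda>_. 1) n t - t^2 / 2"])
  fix t :: real
  show "((\<lambda>t. chord_sum (\<lambda>_. 1) n t - t^2 / 2) has_real_derivative chord_sum' (\<lambda>_. 1) n t - t) (at t)"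
    by (rule derivative_eq_intros chord_sum_deriv refl | simp)+
  have "((\<lambda>t. chord_sum' (\<lambda>_. 1) n t - t) has_real_derivative
      (\<Sum>k<n. 1 * (inv_cb k * (2 - 2 * cos t)^k - inv_cb (Suc k) * (2 - 2 * cos t)^Suc k)) - 1) (at t)"
    by (intro DERIV_diff chord_sum'_deriv DERIV_ident)
  also have "(\<Sum>k<n. 1 * (inv_cb k * (2 - 2 * cos t)^k - inv_cb (Suc k) * (2 - 2 * cos t)^Suc k)) - 1
      = - (inv_cb n * (2 - 2 * cos t)^n)"
    using sum_lessThan_telescope'[of "\<lambda>k. inv_cb k * (2 - 2 * cos t)^k" n]
    by (simp add: inv_cb_def[of 0] del: power_Suc)
  finally show "((\<lambda>t. chord_sum' (\<lambda>_. 1) n t - t) has_real_derivative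
      - (inv_cb n * (2 - 2 * cos t)^n)) (at t)" .
next
  fix t :: real assume "0 \<le> t" "t \<le> pi / 3"
  note Y = chord_in_unit[OF this]
  then show "\<bar>- (inv_cb n * (2 - 2 * cos t)^n)\<bar> \<le> inv_cb n"
    using inv_cb_pos[of n] by (simp add: abs_mult power_abs mult_left_le power_le_one)
qed (use assms in auto)

text \<open>
Summation by parts: the differences of \<open>hsum 2\<close> are \<open>1/k\<^sup>2\<close>, so the second derivative of the chord sum
with weights \<open>hsum 2\<close> is the chord sum with constant weights, up to a boundary term.
\<close>
lemma chord_sum_hsum_second_deriv:
  "(\<Sum>k<Suc n. hsum 2 k * (inv_cb k * y^k - inv_cb (Suc k) * y^Suc k))
     = (\<Sum>k<n. inv_cb (Suc k) / real (Suc k)^2 * y ^ Suc k) - hsum 2 n * inv_cb (Suc n) * y ^ Suc n"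
  by (induction n) (auto simp: hsum_Suc algebra_simps simp del: power_Suc of_nat_Suc)

lemma chord_sum_hsum_bound:
  assumes "0 \<le> t" "t \<le> pi / 3"
  shows "\<bar>chord_sum (hsum 2) (Suc n) t - t^4 / 24\<bar>
          \<le> (inv_cb n * (pi/3) * (pi/3) + pi^2/6 * inv_cb (Suc n)) * (pi/3) * (pi/3)"
proof (rule abs_le_of_second_deriv_bound[of "\<lambda>t. chord_sum (hsum 2) (Suc n) t - t^4 / 24"])
  fix t :: real
  let ?f'' = "\<lambda>t. chord_sum (\<lambda>_. 1) n t - t^2 / 2 - hsum 2 n * inv_cb (Suc n) * (2 - 2 * cos t) ^ Suc n"
  show "((\<lambda>t. chord_sum (hsum 2) (Suc n) t - t^4 / 24) has_real_derivative
           chord_sum' (hsum 2) (Suc n) t - t^3 / 6) (at t)"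
    by (rule derivative_eq_intros chord_sum_deriv refl | simp)+
  have "((\<lambda>t. t^3 / 6) has_real_derivative t^2 / 2) (at t)"
    by (rule derivative_eq_intros refl | simp)+
  from DERIV_diff[OF chord_sum'_deriv[of "hsum 2" "Suc n" t] this]
  show "((\<lambda>t. chord_sum' (hsum 2) (Suc n) t - t^3 / 6) has_real_derivative ?f'' t) (at t)"
    unfolding chord_sum_hsum_second_deriv by (simp add: chord_sum_def algebra_simps)
next
  fix t :: real assume t: "0 \<le> t" "t \<le> pi / 3"
  note Y = chord_in_unit[OF t]
  let ?r = "hsum 2 n * inv_cb (Suc n) * (2 - 2 * cos t) ^ Suc n"
  have "\<bar>?r\<bar> = ?r"
    using Y less_imp_le[OF inv_cb_pos] by (intro abs_of_nonneg mult_nonneg_nonneg zero_le_power) auto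
  also have "\<dots> \<le> (pi^2/6 * inv_cb (Suc n)) * 1"
    using Y hsum_2_le less_imp_le[OF inv_cb_pos] power_le_one[OF Y, of "Suc n"]
    by (intro mult_mono) (auto intro!: mult_nonneg_nonneg zero_le_power simp del: power_Suc)
  finally show "\<bar>chord_sum (\<lambda>_. 1) n t - t^2 / 2 - ?r\<bar>
     \<le> inv_cb n * (pi/3) * (pi/3) + pi^2/6 * inv_cb (Suc n)"
    using chord_sum_const_bound[OF t, of n] by linarith
qed (use assms in auto)

lemma hsum_inv_cb_tendsto:
  "(\<lambda>n. \<Sum>k<n. hsum 2 k * inv_cb (Suc k) / real (Suc k)^2) \<longlonglongrightarrow> pi^4 / 1944"
proof -
  let ?B = "\<lambda>n. (inv_cb n * (pi/3) * (pi/3) + pi^2/6 * inv_cb (Suc n)) * (pi/3) * (pi/3)"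
  have "?B
      \<longlonglongrightarrow> (0 * (pi/3) * (pi/3) + pi^2/6 * 0) * (pi/3) * (pi/3)"
    by (intro tendsto_intros inv_cb_tendsto_0 LIMSEQ_Suc[OF inv_cb_tendsto_0])
  then have "?B \<longlonglongrightarrow> 0" by simp
  moreover have "\<forall>\<^sub>F n in sequentially. norm (chord_sum (hsum 2) (Suc n) (pi/3) - (pi/3)^4 / 24) \<le> ?B n"
    unfolding real_norm_def by (intro always_eventually allI chord_sum_hsum_bound) auto
  ultimately have "(\<lambda>n. chord_sum (hsum 2) (Suc n) (pi/3) - (pi/3)^4 / 24) \<longlonglongrightarrow> 0"
    by (rule Lim_null_comparison[rotated])
  then have "(\<lambda>n. chord_sum (hsum 2) (Suc n) (pi/3)) \<longlonglongrightarrow> (pi/3)^4 / 24"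
    by (simp add: LIM_zero_iff)
  then have "(\<lambda>n. chord_sum (hsum 2) n (pi/3)) \<longlonglongrightarrow> (pi/3)^4 / 24"
    by (rule LIMSEQ_imp_Suc)
  then show ?thesis by (simp add: chord_sum_def[abs_def] cos_60 power_divide)
qed

section \<open>A finite form of Leshchiner's identity\<close>

text \<open>
Apery's telescoping sum
\<open>\<Sum>k\<le>m. (-1)\<^sup>k\<^sup>-\<^sup>1 (1\<^sup>2 - x\<^sup>2)\<cdots>((k-1)\<^sup>2 - x\<^sup>2) / ((n\<^sup>2 - 1\<^sup>2)\<cdots>(n\<^sup>2 - k\<^sup>2))
= (1 - (-1)\<^sup>m (1\<^sup>2 - x\<^sup>2)\<cdots>(m\<^sup>2 - x\<^sup>2) / ((n\<^sup>2 - 1\<^sup>2)\<cdots>(n\<^sup>2 - m\<^sup>2))) / (n\<^sup>2 - x\<^sup>2)\<close>,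
of which this is the coefficient of \<open>x\<^sup>2\<close> with the sign reversed. The numerators contribute
\<open>-((k-1)!)\<^sup>2 h\<^sub>k\<close>, and the denominators are
\<open>(n\<^sup>2 - 1\<^sup>2)\<cdots>(n\<^sup>2 - k\<^sup>2) = (n+k)! / (n (n-k-1)!)\<close>. The summation index is shifted by one.
\<close>
lemma apery_telescope:
  "m < n \<Longrightarrow> (\<Sum>k<m. (-1)^k * hsum 2 k * (fact k)\<^sup>2 * real n * fact (n - k - 2) / fact (n + k + 1))
     = - 1 / real n ^ 4 + (-1)^m * (fact m)\<^sup>2 * real n * fact (n - m - 1) / fact (n + m)
         * (1 / real n ^ 4 - hsum 2 m / real n ^ 2)"
proof (induction m)
  case 0
  then obtain j where "n = Suc j" by (cases n) auto
  then show ?case by (simp add: fact_Suc)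
next
  case (Suc m)
  then obtain j where n: "n = m + 2 + j" by (metis Suc_leI add_2_eq_Suc' le_iff_add add_Suc_right)
  define h where "h = hsum 2 m"
  define X where "X = (-1)^m * (fact m)\<^sup>2 * real n * fact j / fact (n + m + 1)"
  have pos: "real n > 0" "real m + 1 > 0" by (simp_all add: n)
  have f1: "fact (n - m - 1) = (real n - real m - 1) * fact j" by (simp add: n algebra_simps)
  have f2: "fact (n + m + 1) = (real n + real m + 1) * fact (n + m)" by simp
  have "(\<Sum>k<Suc m. (-1)^k * hsum 2 k * (fact k)\<^sup>2 * real n * fact (n - k - 2) / fact (n + k + 1))
      = - 1 / real n ^ 4 + (-1)^m * (fact m)\<^sup>2 * real n * fact (n - m - 1) / fact (n + m)
         * (1 / real n ^ 4 - h / real n ^ 2)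
        + (-1)^m * h * (fact m)\<^sup>2 * real n * fact (n - m - 2) / fact (n + m + 1)"
    using Suc by (simp add: h_def)
  also have "(-1)^m * (fact m)\<^sup>2 * real n * fact (n - m - 1) / fact (n + m)
      = X * ((real n + real m + 1) * (real n - real m - 1))"
    unfolding X_def f1 f2 by (simp add: divide_simps)
  also have "(-1)^m * h * (fact m)\<^sup>2 * real n * fact (n - m - 2) / fact (n + m + 1) = X * h"
    by (simp add: X_def n)
  finally have step: "(\<Sum>k<Suc m. (-1)^k * hsum 2 k * (fact k)\<^sup>2 * real n * fact (n - k - 2) / fact (n + k + 1))
     = - 1 / real n ^ 4 +
         (X * ((real n + real m + 1) * (real n - real m - 1)) * (1 / real n ^ 4 - h / real n ^ 2) + X * h)"
    by simp
  also have "X * ((real n + real m + 1) * (real n - real m - 1)) * (1 / real n ^ 4 - h / real n ^ 2) + X * h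
     = - X * (real m + 1)\<^sup>2 * (1 / real n ^ 4 - (h + 1 / (real m + 1)\<^sup>2) / real n ^ 2)"
    using pos by (simp add: divide_simps) (simp add: algebra_simps eval_nat_numeral)
  also have "- X * (real m + 1)\<^sup>2
     = (-1)^Suc m * (fact (Suc m))\<^sup>2 * real n * fact (n - Suc m - 1) / fact (n + Suc m)"
  proof -
    have "n - Suc m - 1 = j" "n + Suc m = n + m + 1" by (simp_all add: n)
    moreover have "(fact (Suc m))\<^sup>2 = (real m + 1)\<^sup>2 * (fact m)\<^sup>2"
      by (simp add: power_mult_distrib add.commute)
    ultimately show ?thesis unfolding X_def by simp
  qed
  finally show ?case
    by (simp add: h_def hsum_Suc add.commute)
qed

text \<open>
Twice the \<open>k\<close>-th term of Apery's sum for \<open>n + 1\<close> (without sign and harmonic factor) is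
\<open>wz_term (n + 1) k + wz_term n k\<close>. The alternating sum over \<open>n\<close> of these terms therefore telescopes
for each fixed \<open>k\<close>.
\<close>
definition wz_term :: "nat \<Rightarrow> nat \<Rightarrow> real" where
  "wz_term n k = (fact k)\<^sup>2 * fact (n - Suc k) / fact (n + Suc k)"

lemma wz_term_add_Suc:
  assumes "k < n"
  shows "wz_term (Suc n) k + wz_term n k
     = 2 * ((fact k)\<^sup>2 * real (Suc n) * fact (Suc n - k - 2) / fact (Suc n + k + 1))"
proof -
  obtain j where n: "n = Suc (k + j)" using assms by (metis less_iff_Suc_add)
  define F where "F = (fact (n + Suc k) :: real)"
  have F: "F > 0" by (simp add: F_def)
  have "wz_term (Suc n) k = (fact k)\<^sup>2 * ((real j + 1) * fact j) / ((real n + real k + 2) * F)"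
    by (simp add: wz_term_def n F_def algebra_simps)
  moreover have "wz_term n k = (fact k)\<^sup>2 * fact j / F"
    by (simp add: wz_term_def n F_def)
  moreover have "fact (Suc n + k + 1) = (real n + real k + 2) * F"
    by (simp add: F_def algebra_simps)
  moreover have "Suc n - k - 2 = j" by (simp add: n)
  moreover have "(real j + 1) / ((real n + real k + 2) * F) + 1 / F
      = 2 * real (Suc n) / ((real n + real k + 2) * F)"
    using F by (simp add: n divide_simps) (simp add: algebra_simps)?
  then have "(fact k)\<^sup>2 * fact j * ((real j + 1) / ((real n + real k + 2) * F) + 1 / F)
      = (fact k)\<^sup>2 * fact j * (2 * real (Suc n) / ((real n + real k + 2) * F))"
    by (rule arg_cong)
  ultimately show ?thesis
    by (simp only:) (simp add: algebra_simps)
qed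

lemma wz_term_diag: "wz_term (Suc n) n = inv_cb (Suc n) / real (Suc n)^2"
proof -
  have "2 * Suc n = Suc n + Suc n" by simp
  then show ?thesis
    by (simp add: wz_term_def inv_cb_fact power2_eq_square del: mult_Suc_right of_nat_Suc)
qed

text \<open>
The term is \<open>1 / (k\<^sup>2 B B')\<close>, at shifted index, with the binomial coefficients \<open>B = n choose k\<close>
and \<open>B' = (n+k) choose k\<close>; the estimates \<open>B \<ge> 1\<close> and \<open>B' \<ge> n + 1\<close> suffice for the remainder to vanish.
\<close>
lemma wz_term_le:
  assumes "k < n"
  shows "wz_term n k \<le> 1 / real (Suc k)^2 / real (Suc n)"
proof -
  have "wz_term n k = 1 / real (Suc k)^2 / (real (n choose Suc k) * real ((n + Suc k) choose Suc k))"
    using assms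
    by (subst (1 2) binomial_fact) (simp_all add: wz_term_def power2_eq_square divide_simps del: of_nat_Suc)
  also have "\<dots> \<le> 1 / real (Suc k)^2 / real (Suc n)"
  proof (intro divide_left_mono)
    have "1 \<le> n choose Suc k" using assms by (simp add: Suc_le_eq zero_less_binomial)
    then have "1 * Suc n \<le> (n choose Suc k) * ((n + Suc k) choose Suc k)"
      using binomial_add_ge[of n k] by (intro mult_le_mono) (simp_all only: Suc_eq_plus1)
    then show "real (Suc n) \<le> real (n choose Suc k) * real ((n + Suc k) choose Suc k)"
      by (simp only: of_nat_le_iff mult_1 flip: of_nat_mult)
  qed (use assms in \<open>auto simp: zero_less_binomial simp del: binomial_Suc_Suc\<close>)
  finally show ?thesis .
qed

text \<open>
After the sum over \<open>n\<close> has been telescoped for each \<open>k\<close>, the lower ends give a multiple of the series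
\<open>T\<close>; the upper ends are collected here.
\<close>
definition leshchiner_rem :: "nat \<Rightarrow> real" where
  "leshchiner_rem n = (\<Sum>k<n. (-1)^(k + n) * hsum 2 k * wz_term n k) / 2"

lemma leshchiner_rem_Suc:
  "leshchiner_rem (Suc n) = leshchiner_rem n + (-1)^n / real (Suc n)^4
     - 2 * inv_cb (Suc n) / real (Suc n)^4 + 3/2 * (hsum 2 n * inv_cb (Suc n) / real (Suc n)^2)"
proof -
  let ?N = "real (Suc n)"
  define b where "b = inv_cb (Suc n)"
  define W where "W = (\<Sum>k<n. (-1)^(k + Suc n) * hsum 2 k * (wz_term (Suc n) k + wz_term n k))"
  define R where "R = (\<Sum>k<n. (-1)^k * hsum 2 k * (fact k)\<^sup>2 * ?N * fact (Suc n - k - 2) / fact (Suc n + k + 1))"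
  have "2 * (leshchiner_rem (Suc n) - leshchiner_rem n)
     = - (hsum 2 n * wz_term (Suc n) n)
       + W"
  proof -
    have "W
        = (\<Sum>k<n. (-1)^(k + Suc n) * hsum 2 k * wz_term (Suc n) k)
          - (\<Sum>k<n. (-1)^(k + n) * hsum 2 k * wz_term n k)"
      unfolding W_def sum_subtractf[symmetric] by (intro sum.cong refl) (simp add: algebra_simps)
    moreover have "(-1::real) ^ (n + Suc n) = -1" by simp
    ultimately show ?thesis
      by (simp add: leshchiner_rem_def right_diff_distrib del: power_Suc add_Suc_right)
  qed
  also have "W = - 2 * (-1)^n * R"
    unfolding W_def R_def sum_distrib_left
  proof (intro sum.cong refl)
    have rearrange: "- (s * t) * h * (2 * (f * N * g / F)) = - 2 * s * (t * h * f * N * g / F)"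
      for s t h f N g F :: real by simp
    fix k assume "k \<in> {..<n}"
    then have "wz_term (Suc n) k + wz_term n k
        = 2 * ((fact k)\<^sup>2 * ?N * fact (Suc n - k - 2) / fact (Suc n + k + 1))"
      by (intro wz_term_add_Suc) simp
    moreover have "(-1::real) ^ (k + Suc n) = - ((-1)^n * (-1)^k)" by (simp add: power_add)
    ultimately show "(-1)^(k + Suc n) * hsum 2 k * (wz_term (Suc n) k + wz_term n k)
      = - 2 * (-1)^n * ((-1)^k * hsum 2 k * (fact k)\<^sup>2 * ?N * fact (Suc n - k - 2) / fact (Suc n + k + 1))"
      by (simp only: rearrange)
  qed
  also have "R = - 1 / ?N ^ 4 + (-1)^n * (2 * b) * (1 / ?N ^ 4 - hsum 2 n / ?N ^ 2)"
  proof -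
    have "(fact n)\<^sup>2 * ?N * fact (Suc n - n - 1) / fact (Suc n + n) = 2 * b"
    proof -
      have "2 * Suc n = Suc (Suc n + n)" by simp
      then have "fact (2 * Suc n) = 2 * ?N * fact (Suc n + n)"
        by (simp only: fact_Suc) simp
      moreover have "(fact (Suc n))\<^sup>2 = ?N * ?N * (fact n)\<^sup>2"
        by (simp add: power2_eq_square)
      ultimately show ?thesis
        unfolding b_def inv_cb_fact by (simp add: divide_simps del: of_nat_Suc mult_Suc_right fact_Suc)
    qed
    then have "(-1)^n * (fact n)\<^sup>2 * ?N * fact (Suc n - n - 1) / fact (Suc n + n) = (-1)^n * (2 * b)"
      by (metis mult.assoc times_divide_eq_right)
    then show ?thesis
      unfolding R_def by (subst apery_telescope) simp_all
  qed
  also have "- 2 * (-1)^n * (- 1 / ?N ^ 4 + (-1)^n * (2 * b) * (1 / ?N ^ 4 - hsum 2 n / ?N ^ 2))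
     = 2 * (-1)^n / ?N^4 - 4 * b * (1 / ?N ^ 4 - hsum 2 n / ?N ^ 2)"
  proof -
    have "- 2 * s * (- c + s * (2 * b) * A) = 2 * s * c - 4 * b * A * (s * s)" for s c A :: real
      by (simp add: algebra_simps)
    from this[of "(-1)^n" "1 / ?N ^ 4"] show ?thesis
      by (simp flip: power_mult_distrib)
  qed
  finally have "2 * leshchiner_rem (Suc n) = 2 * (leshchiner_rem n + (-1)^n / ?N^4
     - 2 * b / ?N^4 + 3/2 * (hsum 2 n * b / ?N^2))"
    unfolding wz_term_diag b_def[symmetric] by (simp add: algebra_simps del: of_nat_Suc)
  then show ?thesis unfolding b_def mult_cancel_left by (simp only: zero_neq_numeral[symmetric] simp_thms)
qed

lemma leshchiner_finite:
  "(\<Sum>k<n. (-1)^k / real (Suc k)^4)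
     = 2 * (\<Sum>k<n. inv_cb (Suc k) / real (Suc k)^4)
       - 3/2 * (\<Sum>k<n. hsum 2 k * inv_cb (Suc k) / real (Suc k)^2) + leshchiner_rem n"
proof (induction n)
  case (Suc n)
  then show ?case
    by (simp add: leshchiner_rem_Suc algebra_simps del: of_nat_Suc)
qed (simp add: leshchiner_rem_def)

lemma leshchiner_rem_bound: "\<bar>leshchiner_rem n\<bar> \<le> (pi\<^sup>2 / 6)\<^sup>2 * (1 / real (Suc n))"
proof -
  have "\<bar>leshchiner_rem n\<bar> \<le> \<bar>\<Sum>k<n. (-1)^(k + n) * hsum 2 k * wz_term n k\<bar>"
    by (simp add: leshchiner_rem_def)
  also have "\<dots> \<le> (\<Sum>k<n. \<bar>(-1)^(k + n) * hsum 2 k * wz_term n k\<bar>)"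
    by (rule sum_abs)
  also have "\<dots> \<le> (\<Sum>k<n. pi\<^sup>2 / 6 * (1 / real (Suc k)^2 / real (Suc n)))"
  proof (intro sum_mono)
    fix k assume "k \<in> {..<n}"
    then have "wz_term n k \<le> 1 / real (Suc k)^2 / real (Suc n)" by (intro wz_term_le) simp
    moreover have "0 \<le> wz_term n k" by (simp add: wz_term_def)
    ultimately have "hsum 2 k * wz_term n k \<le> pi\<^sup>2 / 6 * (1 / real (Suc k)^2 / real (Suc n))"
      by (intro mult_mono hsum_2_le) simp_all
    with \<open>0 \<le> wz_term n k\<close>
    show "\<bar>(-1)^(k + n) * hsum 2 k * wz_term n k\<bar> \<le> pi\<^sup>2 / 6 * (1 / real (Suc k)^2 / real (Suc n))"
      by (simp add: abs_mult power_abs del: of_nat_Suc)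
  qed
  also have "\<dots> = pi\<^sup>2 / 6 * hsum 2 n * (1 / real (Suc n))"
    unfolding hsum_def mult.assoc sum_distrib_left[symmetric] sum_distrib_right
    by (simp del: of_nat_Suc)
  also have "\<dots> \<le> pi\<^sup>2 / 6 * (pi\<^sup>2 / 6) * (1 / real (Suc n))"
    by (intro mult_right_mono mult_left_mono hsum_2_le) auto
  finally show ?thesis by (simp add: power2_eq_square)
qed

lemma leshchiner_rem_tendsto_0: "leshchiner_rem \<longlonglongrightarrow> 0"
proof (rule Lim_null_comparison)
  have "(\<lambda>n. (pi\<^sup>2 / 6)\<^sup>2 * (1 / real (Suc n))) \<longlonglongrightarrow> (pi\<^sup>2 / 6)\<^sup>2 * 0"
    by (intro tendsto_intros LIMSEQ_Suc[OF lim_1_over_n])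
  then show "(\<lambda>n. (pi\<^sup>2 / 6)\<^sup>2 * (1 / real (Suc n))) \<longlonglongrightarrow> 0" by simp
qed (simp only: real_norm_def leshchiner_rem_bound always_eventually simp_thms)

theorem mainTheorem2:
  shows "(\<lambda>k::nat. 1 / (real (Suc k) ^ 4 * real ((2 * Suc k) choose (Suc k)))) sums (17 * pi ^ 4 / 3240)"
proof -
  let ?a = "\<lambda>k::nat. 1 / (real (Suc k) ^ 4 * real ((2 * Suc k) choose (Suc k)))"
  define S where "S n = (\<Sum>k<n. ?a k)" for n
  have S_eq: "S n = (\<Sum>k<n. inv_cb (Suc k) / real (Suc k)^4)" for n
    by (simp add: S_def inv_cb_def mult.commute del: of_nat_Suc binomial_Suc_Suc mult_Suc_right)
  have S_alt: "S = (\<lambda>n. ((\<Sum>k<n. (-1)^k / real (Suc k)^4)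
      + 3/2 * (\<Sum>k<n. hsum 2 k * inv_cb (Suc k) / real (Suc k)^2) - leshchiner_rem n) / 2)"
    using leshchiner_finite by (simp add: S_eq fun_eq_iff)
  have "S \<longlonglongrightarrow> (7 * pi^4 / 720 + 3/2 * (pi^4 / 1944) - 0) / 2"
    unfolding S_alt
    by (intro tendsto_intros alternating_hsum_4_tendsto hsum_inv_cb_tendsto
          leshchiner_rem_tendsto_0) simp_all
  then show ?thesis by (simp add: sums_def S_def[abs_def])
qed

end
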